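(* Let $n\ge 3$ and let $P$ be any $n$-bit permutation all of whose row numbers are at normal positions. Let $R$ be the ordered set of gates output by the algorithm $\mathcal{A}'_{\rm red}$ described in the context on input $P$. Then the number of Toffoli gates of $R$ (counted with the conversion convention in the context) is at most $\mathcal{N}_c(n)+\mathcal{N}_a(n)$, where $$\mathcal{N}_c(n)=\sum_{i=2}^{n-1}(2i-3)\cdot 2^{n-i},\qquad \mathcal{N}_a(n)=\sum_{j=2}^{n-2}\sum_{i=2}^{n-j}(2i-3)\binom{n-j}{i},$$ with $\mathcal{N}_a(3)=0$.
   Context: An $n$-bit permutation is a bijection of $\{0,\dots,2^n-1\}$ in one-line notation $P=(r_0,\dots,r_{2^n-1})$; $x$ is the column number, $r_x$ the row number. Integers $x\in\{0,\dots,2^n-1\}$ are identified with $n$-bit strings $x_1\cdots x_n$ ($x_1$ most significant), and block-wise positions $t\in\{0,\dots,2^{n-1}-1\}$ with $(n-1)$-bit strings $t_1\cdots t_{n-1}$ ($t_1$ most significant); note bit $k$ of column $2t$ or $2t+1$ equals $t_k$ for $k\le n-1$. All row numbers are at normal positions means $r_x\equiv x\pmod 2$ for all $x$. Gates: for $I\subseteq\{1,\dots,n\}$, $k\notin I$, $CX_{I:k}$ flips bit $k$ of $x$ when $x_i=1$ for all $i\in I$ (a $C^{|I|}X$ gate); $X_k=CX_{\emptyset:k}$, $CX_{jk}=CX_{\{j\}:k}$. Applying gate $g$ to $P=(r_x)$ gives $(r'_x)$ with $r'_x=r_{g(x)}$. Toffoli count: a $C^kX$ gate with $k\ge 2$ counts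 as $2k-3$ Toffoli gates, and gates with $k\le 1$ count $0$. Let $h_n(x)=2^n-2^{n-x+1}$ and for $0\le i\le 2^{n-1}-1$ let $m(i)$ be the smallest positive integer with $2i\le h_n(m(i))$. Algorithm $\mathcal{A}'_{\rm red}$: start with $R=()$ and the current permutation $P$. For $i=0,1,\dots,2^{n-1}-1$ in order, with $m=m(i)$: (PICK) scan $j=h_n(m),h_n(m)+1,\dots,2^n-2$ in increasing order, set $a=r_j$ and let $b$ be $a$ with its least significant bit flipped; stop at the first $j$ for which $b=r_t$ for some $t>j$, and select $(a,b)$. (CONS) Let $\alpha,\beta$ be the current columns of $a,b$, $\gamma=\alpha\oplus\beta$ (bitwise XOR), $\delta$ the smallest index with $\gamma_\delta=1$. If $\delta\ne n$: if $i_\delta=1$ append $X_\delta$; append $CX_{\delta k}$ for each $k=\delta+1,\dots,n-1$ with $\gamma_k=1$; if $i_\delta=1$ append $X_\delta$; then append $CX_{I:\delta}$ with $I=\{1,\dots,m-1\}\cup\{n\}$; apply these gates to $P$ and append them to $R$. (ALLOC) Let $s=\lfloor\alpha'/2\rfloor$ where $\alpha'$ is the current column of $a$. If $s\ne i$: let $\gamma=s\oplus i$ as $(n-1)$-bit strings and $\delta$ the smallest index with $\gamma_\delta=1$; append $CX_{\delta k}$ for each $k=\delta+1,\dots,n-1$ with $\gamma_k=1$, then append $CX_{I:\delta}$ with $I=\{k:\delta<k\le n-1,\ i_k=1\}$; apply these gates to $P$ and append them to $R$. After the loop, output $R$ (and the final permutation). *)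

theory Defs
  imports Main
begin

text \<open>
  An \<open>n\<close>-bit permutation is a function restricted to columns \<open>x < 2 ^ n\<close>, with \<open>r x\<close> the row
  number in column \<open>x\<close>; its values outside \<open>{..<2 ^ n}\<close> are never inspected. String positions
  run from \<open>1\<close> (most significant) to \<open>l\<close>, so position \<open>k\<close> is the library bit \<open>l - k\<close>.
\<close>

definition is_perm :: "nat \<Rightarrow> (nat \<Rightarrow> nat) \<Rightarrow> bool" where
  "is_perm n r \<longleftrightarrow> bij_betw r {..<2 ^ n} {..<2 ^ n}"

definition normal_positions :: "nat \<Rightarrow> (nat \<Rightarrow> nat) \<Rightarrow> bool" where
  "normal_positions n r \<longleftrightarrow> (\<forall>x<2 ^ n. r x mod 2 = x mod 2)"

definition str_bit :: "nat \<Rightarrow> nat \<Rightarrow> nat \<Rightarrow> bool" where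
  "str_bit l x k \<longleftrightarrow> bit x (l - k)"

definition first_one :: "nat \<Rightarrow> nat \<Rightarrow> nat" where
  "first_one l x = (LEAST k. k \<in> {1..l} \<and> str_bit l x k)"

datatype gate = CX (controls: "nat set") (target: nat)

definition gate_fun :: "nat \<Rightarrow> gate \<Rightarrow> nat \<Rightarrow> nat" where
  "gate_fun n g x =
     (if \<forall>i\<in>controls g. str_bit n x i then flip_bit (n - target g) x else x)"

definition apply_gate :: "nat \<Rightarrow> gate \<Rightarrow> (nat \<Rightarrow> nat) \<Rightarrow> nat \<Rightarrow> nat" where
  "apply_gate n g r = (\<lambda>x. r (gate_fun n g x))"

definition apply_gates :: "nat \<Rightarrow> gate list \<Rightarrow> (nat \<Rightarrow> nat) \<Rightarrow> nat \<Rightarrow> nat" where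
  "apply_gates n gs r = fold (apply_gate n) gs r"

definition toffoli_cost :: "gate \<Rightarrow> nat" where
  "toffoli_cost g =
     (let k = card (controls g) in if 2 \<le> k then 2 * k - 3 else 0)"

definition toffoli_count :: "gate list \<Rightarrow> nat" where
  "toffoli_count R = (\<Sum>g\<leftarrow>R. toffoli_cost g)"

definition h :: "nat \<Rightarrow> nat \<Rightarrow> nat" where
  "h n x = 2 ^ n - 2 ^ (n + 1 - x)"

definition m_of :: "nat \<Rightarrow> nat \<Rightarrow> nat" where
  "m_of n i = (LEAST m. 0 < m \<and> 2 * i \<le> h n m)"

definition column :: "nat \<Rightarrow> (nat \<Rightarrow> nat) \<Rightarrow> nat \<Rightarrow> nat" where
  "column n r a = inv_into {..<2 ^ n} r a"

text \<open>
  The scan always succeeds for permutations at normal positions whose blocks before the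
  current one are already paired; otherwise the \<open>LEAST\<close> below may be unspecified.
\<close>

definition pick :: "nat \<Rightarrow> nat \<Rightarrow> (nat \<Rightarrow> nat) \<Rightarrow> nat \<times> nat" where
  "pick n m r =
     (let j = (LEAST j. h n m \<le> j \<and> j \<le> 2 ^ n - 2 \<and>
                 (\<exists>t. j < t \<and> t < 2 ^ n \<and> flip_bit 0 (r j) = r t))
      in (r j, flip_bit 0 (r j)))"

definition cons_gates :: "nat \<Rightarrow> nat \<Rightarrow> nat \<Rightarrow> nat \<Rightarrow> nat \<Rightarrow> gate list" where
  "cons_gates n i m \<alpha> \<beta> =
     (let \<gamma> = Bit_Operations.xor \<alpha> \<beta>;
          \<delta> = first_one n \<gamma>;
          xs = (if str_bit (n - 1) i \<delta> then [CX {} \<delta>] else [])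
      in if \<delta> = n then []
         else xs @ map (\<lambda>k. CX {\<delta>} k) (filter (str_bit n \<gamma>) [\<delta> + 1..<n]) @ xs
                @ [CX ({1..m - 1} \<union> {n}) \<delta>])"

definition alloc_gates :: "nat \<Rightarrow> nat \<Rightarrow> nat \<Rightarrow> gate list" where
  "alloc_gates n i s =
     (let \<gamma> = Bit_Operations.xor s i;
          \<delta> = first_one (n - 1) \<gamma>
      in if s = i then []
         else map (\<lambda>k. CX {\<delta>} k) (filter (str_bit (n - 1) \<gamma>) [\<delta> + 1..<n])
              @ [CX {k. \<delta> < k \<and> k \<le> n - 1 \<and> str_bit (n - 1) i k} \<delta>])"

definition red_step ::
  "nat \<Rightarrow> nat \<Rightarrow> gate list \<times> (nat \<Rightarrow> nat) \<Rightarrow> gate list \<times> (nat \<Rightarrow> nat)" where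
  "red_step n i = (\<lambda>(R, r).
     let m = m_of n i;
         (a, b) = pick n m r;
         C = cons_gates n i m (column n r a) (column n r b);
         r' = apply_gates n C r;
         A = alloc_gates n i (column n r' a div 2)
     in (R @ C @ A, apply_gates n A r'))"

definition A_red :: "nat \<Rightarrow> (nat \<Rightarrow> nat) \<Rightarrow> gate list \<times> (nat \<Rightarrow> nat)" where
  "A_red n P = fold (red_step n) [0..<2 ^ (n - 1)] ([], P)"

definition N_c :: "nat \<Rightarrow> nat" where
  "N_c n = (\<Sum>i = 2..n - 1. (2 * i - 3) * 2 ^ (n - i))"

definition N_a :: "nat \<Rightarrow> nat" where
  "N_a n = (\<Sum>j = 2..n - 2. \<Sum>i = 2..n - j. (2 * i - 3) * ((n - j) choose i))"

end

theory Submission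
  imports Defs
begin

text \<open>
  Work with columns as \<open>n\<close>-bit strings and put \<open>c = 2 * i\<close>. Before step \<open>i\<close> the blocks below
  column \<open>c\<close> are paired, i.e. \<open>r\<close> commutes with flipping the last bit there. Every group of
  gates in a step maps the columns below \<open>c\<close> to themselves, and the step brings the selected
  pair into block \<open>i\<close>, so pairedness propagates. The selected rows stay in columns
  \<open>\<ge> h n m \<ge> c\<close>, which has two consequences. At the last step (\<open>m = n\<close>) the pair already
  forms a block, so no CONS gate is needed, and the multiplicities \<open>2 ^ (n - m)\<close> of the values
  \<open>m\<close> give \<open>N_c\<close>. In ALLOC the block \<open>s\<close> satisfies \<open>i \<le> s\<close>, so the target is a zero of \<open>i\<close>
  and the controls are among the ones after the first zero of \<open>i\<close>; since every bit pattern occurs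
  exactly once after each possible first zero, the total is \<open>N_a\<close>.
\<close>

subsection \<open>Bit strings\<close>

lemma bit_less_self_bound:
  fixes x :: nat assumes "x < 2 ^ n" "n \<le> e" shows "\<not> bit x e"
  using assms by (metis bit_take_bit_iff not_less take_bit_nat_eq_self)

lemma less_power_iff_bit:
  fixes x :: nat shows "x < 2 ^ n \<longleftrightarrow> (\<forall>e\<ge>n. \<not> bit x e)"
proof
  assume "\<forall>e\<ge>n. \<not> bit x e"
  then have "take_bit n x = x"
    by (intro bit_eqI) (auto simp: bit_take_bit_iff not_le[symmetric])
  then show "x < 2 ^ n" by (simp add: take_bit_nat_eq_self_iff)
qed (blast dest: bit_less_self_bound)

lemma str_bit_eqI:
  assumes "x < 2 ^ n" "y < 2 ^ n" and "\<And>p. p \<in> {1..n} \<Longrightarrow> str_bit n x p = str_bit n y p"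
  shows "x = y"
proof (rule bit_eqI)
  fix e
  show "bit x e = bit y e"
  proof (cases "e < n")
    case True
    then show ?thesis using assms(3)[of "n - e"] by (auto simp: str_bit_def)
  qed (use assms in \<open>auto simp: less_power_iff_bit\<close>)
qed

lemma flip_bit_less_power: "x < 2 ^ n \<Longrightarrow> e < n \<Longrightarrow> flip_bit e x < 2 ^ n" for x :: nat
  by (auto simp: less_power_iff_bit bit_flip_bit_iff)

lemma str_bit_flip_bit:
  "k \<in> {1..n} \<Longrightarrow> p \<in> {1..n} \<Longrightarrow>
    str_bit n (flip_bit (n - k) x) p \<longleftrightarrow> str_bit n x p \<noteq> (p = k)"
  by (auto simp: str_bit_def bit_flip_bit_iff)

text \<open>Numbers of equal length compare lexicographically. Whether a gate keeps a column below
  \<open>c\<close> is thus decided by what it does up to the first position where the column differs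
  from \<open>c\<close>.\<close>

lemma less_iff_first_difference:
  assumes "x < 2 ^ n" "y < 2 ^ n"
  shows "x < y \<longleftrightarrow> (\<exists>e\<in>{1..n}. \<not> str_bit n x e \<and> str_bit n y e \<and>
    (\<forall>p\<in>{1..<e}. str_bit n x p = str_bit n y p))"
proof -
  have less: "x < y" if e: "e \<in> {1..n}" "\<not> str_bit n x e" "str_bit n y e"
    "\<forall>p\<in>{1..<e}. str_bit n x p = str_bit n y p"
    and b: "x < 2 ^ n" "y < 2 ^ n" for x y e
  proof -
    let ?d = "n - e"
    \<comment> \<open>The prefixes before position \<open>e\<close> coincide, so after keeping one
      more bit the parities decide the order.\<close>
    have eq: "drop_bit (Suc ?d) x = drop_bit (Suc ?d) y"
    proof (rule bit_eqI)
      fix q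
      show "bit (drop_bit (Suc ?d) x) q = bit (drop_bit (Suc ?d) y) q"
      proof (cases "Suc ?d + q < n")
        case True
        then have "e - Suc q \<in> {1..<e}" "n - (e - Suc q) = Suc ?d + q" using e(1) by auto
        then show ?thesis using e(4) unfolding str_bit_def bit_drop_bit_eq comp_def by metis
      qed (use b in \<open>auto simp: bit_drop_bit_eq bit_less_self_bound\<close>)
    qed
    have "drop_bit (Suc ?d) z = drop_bit ?d z div 2" for z :: nat
      by (simp add: drop_bit_Suc drop_bit_half)
    then have "drop_bit ?d x div 2 = drop_bit ?d y div 2" using eq by simp
    moreover have "odd (drop_bit ?d y)" "even (drop_bit ?d x)"
      using e by (auto simp: str_bit_def bit_iff_odd_drop_bit)
    ultimately have "drop_bit ?d x < drop_bit ?d y" by presburger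
    then show ?thesis by (metis div_le_mono drop_bit_eq_div not_le)
  qed
  show ?thesis
  proof
    assume "x < y"
    then obtain p where "p \<in> {1..n} \<and> str_bit n x p \<noteq> str_bit n y p"
      using str_bit_eqI[OF assms] by blast
    then obtain e where e: "e \<in> {1..n}" "str_bit n x e \<noteq> str_bit n y e"
      and min: "\<forall>p<e. \<not> (p \<in> {1..n} \<and> str_bit n x p \<noteq> str_bit n y p)"
      using exists_least_iff[of "\<lambda>p. p \<in> {1..n} \<and> str_bit n x p \<noteq> str_bit n y p"] by metis
    have before: "\<forall>p\<in>{1..<e}. str_bit n x p = str_bit n y p" using min e(1) by auto
    have "\<not> (str_bit n x e \<and> \<not> str_bit n y e)"
      using less[of e y x] before e(1) assms \<open>x < y\<close> by auto
    then show "\<exists>e\<in>{1..n}. \<not> str_bit n x e \<and> str_bit n y e \<and>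
        (\<forall>p\<in>{1..<e}. str_bit n x p = str_bit n y p)"
      using e before by auto
  qed (use less assms in auto)
qed

text \<open>The leading one of an XOR is the first disagreement of the two strings. Distinctness
  makes the \<open>LEAST\<close> in \<open>first_one\<close> attained.\<close>

lemma first_one_xor:
  assumes "x < 2 ^ l" "y < 2 ^ l" "x \<noteq> y"
  defines "d \<equiv> first_one l (Bit_Operations.xor x y)"
  shows "d \<in> {1..l}" "str_bit l x d \<noteq> str_bit l y d"
    "\<And>p. p \<in> {1..<d} \<Longrightarrow> str_bit l x p = str_bit l y p"
proof -
  let ?P = "\<lambda>k. k \<in> {1..l} \<and> str_bit l (Bit_Operations.xor x y) k"
  obtain p where "?P p"
    using str_bit_eqI[OF assms(1,2)] assms(3) by (auto simp: str_bit_def bit_xor_iff)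
  then have d: "?P d" unfolding d_def first_one_def by (rule LeastI)
  then show "d \<in> {1..l}" "str_bit l x d \<noteq> str_bit l y d"
    by (auto simp: str_bit_def bit_xor_iff)
  fix p assume p: "p \<in> {1..<d}"
  then have "\<not> ?P p" unfolding d_def first_one_def using not_less_Least by fastforce
  then show "str_bit l x p = str_bit l y p" using p d by (auto simp: str_bit_def bit_xor_iff)
qed

text \<open>In binary, \<open>h n m\<close> is \<open>m - 1\<close> ones followed by zeros. This
  turns the numerical range of the scan into the control condition on positions
  \<open>{1..m - 1}\<close> of the last CONS gate.\<close>

lemma h_le_iff:
  assumes "x < 2 ^ n" "1 \<le> m" "m \<le> n"
  shows "h n m \<le> x \<longleftrightarrow> (\<forall>p\<in>{1..<m}. str_bit n x p)"
proof -
  let ?d = "n + 1 - m"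
  have pow: "(2::nat) ^ n = 2 ^ (m - 1) * 2 ^ ?d" using assms by (simp flip: power_add)
  have q: "drop_bit ?d x < 2 ^ (m - 1)"
    using assms(1) unfolding pow by (simp add: drop_bit_eq_div less_mult_imp_div_less)
  have "h n m = mask (m - 1) * 2 ^ ?d"
    by (simp add: h_def pow mask_eq_exp_minus_1 diff_mult_distrib)
  then have "h n m \<le> x \<longleftrightarrow> mask (m - 1) \<le> drop_bit ?d x"
    by (simp add: drop_bit_eq_div less_eq_div_iff_mult_less_eq)
  also have "\<dots> \<longleftrightarrow> drop_bit ?d x = mask (m - 1)"
    using q by (auto simp: mask_eq_exp_minus_1)
  also have "\<dots> \<longleftrightarrow> (\<forall>e<m - 1. bit x (?d + e))"
  proof
    assume *: "\<forall>e<m - 1. bit x (?d + e)"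
    show "drop_bit ?d x = mask (m - 1)"
      by (rule bit_eqI) (use * q in \<open>auto simp: bit_mask_iff bit_drop_bit_eq less_power_iff_bit not_less[symmetric]\<close>)
  next
    assume *: "drop_bit ?d x = mask (m - 1)"
    show "\<forall>e<m - 1. bit x (?d + e)"
    proof (intro allI impI)
      fix e assume "e < m - 1"
      then have "bit (drop_bit ?d x) e" unfolding * by (simp add: bit_mask_iff)
      then show "bit x (?d + e)" by (simp add: bit_drop_bit_eq)
    qed
  qed
  also have "\<dots> \<longleftrightarrow> (\<forall>p\<in>{1..<m}. str_bit n x p)"
  proof
    assume *: "\<forall>e<m - 1. bit x (?d + e)"
    show "\<forall>p\<in>{1..<m}. str_bit n x p"
    proof
      fix p assume "p \<in> {1..<m}"
      then show "str_bit n x p" using *[rule_format, of "m - 1 - p"] assms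
        by (auto simp: str_bit_def)
    qed
  next
    assume *: "\<forall>p\<in>{1..<m}. str_bit n x p"
    show "\<forall>e<m - 1. bit x (?d + e)"
    proof (intro allI impI)
      fix e assume "e < m - 1"
      then show "bit x (?d + e)" using *[rule_format, of "m - 1 - e"] assms
        by (auto simp: str_bit_def)
    qed
  qed
  finally show ?thesis .
qed

subsection \<open>Gates and pairedness\<close>

text \<open>Shared by single gates and by the CNOT groups: being its own inverse makes new columns
  computable, and preserving parity keeps rows at normal positions.\<close>

definition parity_involution :: "nat \<Rightarrow> (nat \<Rightarrow> nat) \<Rightarrow> bool" where
  "parity_involution n G \<longleftrightarrow> (\<forall>x<2 ^ n. G x < 2 ^ n \<and> G (G x) = x \<and> even (G x) = even x)"

text \<open>Serves both for gate maps, often with \<open>c = 2 ^ n\<close>, and for the row function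
  on the blocks already paired.\<close>

definition commutes_flip :: "nat \<Rightarrow> (nat \<Rightarrow> nat) \<Rightarrow> bool" where
  "commutes_flip c G \<longleftrightarrow> (\<forall>x<c. G (flip_bit 0 x) = flip_bit 0 (G x))"

definition paired :: "nat \<Rightarrow> nat \<Rightarrow> (nat \<Rightarrow> nat) \<Rightarrow> bool" where
  "paired n c r \<longleftrightarrow> is_perm n r \<and> normal_positions n r \<and> commutes_flip c r"

section \<open>Columns, rows and composition with gate maps\<close>

lemma column_eqI: "is_perm n r \<Longrightarrow> x < 2 ^ n \<Longrightarrow> r x = a \<Longrightarrow> column n r a = x"
  unfolding column_def is_perm_def bij_betw_def by (auto intro: inv_into_f_eq)

lemma column_less: "is_perm n r \<Longrightarrow> a < 2 ^ n \<Longrightarrow> column n r a < 2 ^ n"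
  unfolding column_def is_perm_def bij_betw_def by (metis inv_into_into lessThan_iff)

lemma row_column: "is_perm n r \<Longrightarrow> a < 2 ^ n \<Longrightarrow> r (column n r a) = a"
  unfolding column_def is_perm_def bij_betw_def by (metis f_inv_into_f lessThan_iff)

lemma row_less: "is_perm n r \<Longrightarrow> x < 2 ^ n \<Longrightarrow> r x < 2 ^ n"
  unfolding is_perm_def bij_betw_def by blast

lemma flip_bit_0_involutory [simp]: "flip_bit 0 (flip_bit 0 x) = x" for x :: nat
  by (auto simp: bit_eq_iff bit_flip_bit_iff)

lemma is_perm_comp:
  assumes "is_perm n r" "parity_involution n G"
  shows "is_perm n (r \<circ> G)"
proof -
  have "bij_betw G {..<2 ^ n} {..<2 ^ n}"
    using assms(2) unfolding parity_involution_def
    by (intro bij_betw_byWitness[where f' = G]) auto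
  then show ?thesis using assms(1) unfolding is_perm_def by (rule bij_betw_trans)
qed

text \<open>The new column of \<open>a\<close> is the preimage under \<open>G\<close> of the old
  one, which is its image because \<open>G\<close> is an involution.\<close>

lemma column_comp:
  assumes "is_perm n r" "parity_involution n G" "a < 2 ^ n"
  shows "column n (r \<circ> G) a = G (column n r a)"
proof (rule column_eqI)
  have c: "column n r a < 2 ^ n" using assms by (simp add: column_less)
  show "is_perm n (r \<circ> G)" using assms by (simp add: is_perm_comp)
  show "G (column n r a) < 2 ^ n" "(r \<circ> G) (G (column n r a)) = a"
    using assms c by (auto simp: parity_involution_def row_column)
qed

lemma paired_comp:
  assumes "paired n c r" "parity_involution n G" "commutes_flip c G" "\<And>x. x < c \<Longrightarrow> G x < c"
  shows "paired n c (r \<circ> G)"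
proof -
  have "normal_positions n (r \<circ> G)"
    using assms(1,2) unfolding paired_def normal_positions_def parity_involution_def
    by (auto simp: mod2_eq_if)
  moreover have "commutes_flip c (r \<circ> G)"
    using assms unfolding paired_def commutes_flip_def by simp
  ultimately show ?thesis using assms is_perm_comp unfolding paired_def by blast
qed

text \<open>Each gate is composed on the right of \<open>r\<close>, so on a column the last gate of
  the list acts first.\<close>

lemma apply_gates_eq: "apply_gates n gs r = r \<circ> foldr (gate_fun n) gs"
proof (induction gs arbitrary: r)
  case (Cons g gs)
  have "apply_gates n (g # gs) r = apply_gates n gs (apply_gate n g r)"
    by (simp add: apply_gates_def)
  then show ?case unfolding Cons by (auto simp: apply_gate_def)
qed (simp add: apply_gates_def)

lemma apply_gates_append: "apply_gates n (gs @ hs) r = apply_gates n hs (apply_gates n gs r)"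
  by (simp add: apply_gates_def)

section \<open>Bitwise action of a single gate\<close>

lemma gate_fun_less: "target g \<in> {1..n} \<Longrightarrow> x < 2 ^ n \<Longrightarrow> gate_fun n g x < 2 ^ n"
  by (auto simp: gate_fun_def intro!: flip_bit_less_power)

lemma str_bit_gate_fun:
  "target g \<in> {1..n} \<Longrightarrow> p \<in> {1..n} \<Longrightarrow> str_bit n (gate_fun n g x) p \<longleftrightarrow>
    str_bit n x p \<noteq> (p = target g \<and> (\<forall>i\<in>controls g. str_bit n x i))"
  by (auto simp: gate_fun_def str_bit_flip_bit)

lemma foldr_gate_fun_less:
  "target ` set gs \<subseteq> {1..n} \<Longrightarrow> x < 2 ^ n \<Longrightarrow> foldr (gate_fun n) gs x < 2 ^ n"
  by (induction gs) (auto intro: gate_fun_less)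

lemma str_bit_last: "str_bit n x n \<longleftrightarrow> odd x"
  by (simp add: str_bit_def bit_0)

lemma str_bit_flip_last:
  "p \<in> {1..n} \<Longrightarrow> str_bit n (flip_bit 0 x) p \<longleftrightarrow> str_bit n x p \<noteq> (p = n)"
  using str_bit_flip_bit[of n n p x] by auto

lemma flip_last_less: "1 \<le> n \<Longrightarrow> x < 2 ^ n \<Longrightarrow> flip_bit 0 x < 2 ^ n" for x :: nat
  by (auto intro: flip_bit_less_power)

text \<open>The target is no control, so the firing condition is the same before and after the flip;
  a target before position \<open>n\<close> leaves the parity alone.\<close>

lemma parity_involution_gate_fun:
  assumes "target g \<in> {1..<n}" "controls g \<subseteq> {1..n}" "target g \<notin> controls g"
  shows "parity_involution n (gate_fun n g)"
  unfolding parity_involution_def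
proof (intro allI impI conjI)
  fix x :: nat assume x: "x < 2 ^ n"
  have t: "target g \<in> {1..n}" using assms by auto
  show less: "gate_fun n g x < 2 ^ n" using x t by (rule gate_fun_less[rotated])
  have same: "str_bit n (gate_fun n g x) i = str_bit n x i" if "i \<in> controls g" for i
    using str_bit_gate_fun[OF t, of i x] that assms by blast
  show "gate_fun n g (gate_fun n g x) = x"
    by (rule str_bit_eqI[where n = n])
      (use less x same in \<open>auto simp: str_bit_gate_fun[OF t] gate_fun_less[OF t]\<close>)
  show "even (gate_fun n g x) = even x"
    using str_bit_gate_fun[OF t, of n x] assms by (auto simp: str_bit_last)
qed

text \<open>Such a gate neither reads nor writes the last bit. The final CONS gate, having control
  \<open>n\<close>, is not covered.\<close>

lemma commutes_flip_gate_fun: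
  assumes "target g \<in> {1..<n}" "controls g \<subseteq> {1..<n}"
  shows "commutes_flip (2 ^ n) (gate_fun n g)"
  unfolding commutes_flip_def
proof (intro allI impI)
  fix x :: nat assume x: "x < 2 ^ n"
  have t: "target g \<in> {1..n}" and n: "1 \<le> n" using assms by auto
  have same: "str_bit n (flip_bit 0 x) i = str_bit n x i" if "i \<in> controls g" for i
    using str_bit_flip_last[of i n x] that assms by auto
  show "gate_fun n g (flip_bit 0 x) = flip_bit 0 (gate_fun n g x)"
    by (rule str_bit_eqI[where n = n])
      (use n x same assms in \<open>auto simp: str_bit_gate_fun[OF t] gate_fun_less[OF t] flip_last_less str_bit_flip_last\<close>)
qed

text \<open>The CNOT group common to CONS and ALLOC: it flips the positions \<open>ks\<close>
  exactly in the columns whose bit \<delta> differs from \<open>v\<close>.\<close>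

definition clear_gates :: "nat \<Rightarrow> bool \<Rightarrow> nat list \<Rightarrow> gate list" where
  "clear_gates \<delta> v ks = (let xs = if v then [CX {} \<delta>] else [] in xs @ map (\<lambda>k. CX {\<delta>} k) ks @ xs)"

lemma str_bit_foldr_CX:
  assumes "distinct ks" "set ks \<subseteq> {1..n} - {\<delta>}" "\<delta> \<in> {1..n}" "p \<in> {1..n}"
  shows "str_bit n (foldr (gate_fun n) (map (\<lambda>k. CX {\<delta>} k) ks) x) p \<longleftrightarrow>
    str_bit n x p \<noteq> (p \<in> set ks \<and> str_bit n x \<delta>)"
  using assms
proof (induction ks arbitrary: p)
  case (Cons k ks)
  then show ?case by (auto simp: str_bit_gate_fun)
qed simp

lemma clear_gates_less:
  assumes "set ks \<subseteq> {1..n}" "\<delta> \<in> {1..n}" "x < 2 ^ n"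
  shows "foldr (gate_fun n) (clear_gates \<delta> v ks) x < 2 ^ n"
  using assms by (intro foldr_gate_fun_less) (auto simp: clear_gates_def Let_def)

text \<open>For true \<open>v\<close> the two outer \<open>X\<close> gates restore position
  \<delta>, while the CNOTs between them see its negation.\<close>

lemma str_bit_clear_gates:
  assumes "distinct ks" "set ks \<subseteq> {1..n} - {\<delta>}" "\<delta> \<in> {1..n}" "p \<in> {1..n}"
  shows "str_bit n (foldr (gate_fun n) (clear_gates \<delta> v ks) x) p \<longleftrightarrow>
    str_bit n x p \<noteq> (p \<in> set ks \<and> str_bit n x \<delta> \<noteq> v)"
  using assms by (cases v) (auto simp: clear_gates_def str_bit_gate_fun str_bit_foldr_CX)

lemma parity_involution_clear_gates:
  assumes "distinct ks" "set ks \<subseteq> {1..<n} - {\<delta>}" "\<delta> \<in> {1..<n}"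
  shows "parity_involution n (foldr (gate_fun n) (clear_gates \<delta> v ks))"
  unfolding parity_involution_def
proof (intro allI impI conjI)
  fix x :: nat assume x: "x < 2 ^ n"
  let ?G = "foldr (gate_fun n) (clear_gates \<delta> v ks)"
  have ks: "set ks \<subseteq> {1..n} - {\<delta>}" and d: "\<delta> \<in> {1..n}" using assms by auto
  note bits = str_bit_clear_gates[OF assms(1) ks d]
  have less: "?G x < 2 ^ n" if "x < 2 ^ n" for x
    by (rule clear_gates_less) (use ks d that in auto)
  show "?G x < 2 ^ n" using less x .
  show "?G (?G x) = x"
    by (rule str_bit_eqI[where n = n])
      (use less x assms(2) d in \<open>auto simp: bits\<close>)
  show "even (?G x) = even x"
    using bits[of n v x] assms by (auto simp: str_bit_last)
qed

lemma commutes_flip_clear_gates: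
  assumes "distinct ks" "set ks \<subseteq> {1..<n} - {\<delta>}" "\<delta> \<in> {1..<n}"
  shows "commutes_flip (2 ^ n) (foldr (gate_fun n) (clear_gates \<delta> v ks))"
  unfolding commutes_flip_def
proof (intro allI impI)
  fix x :: nat assume x: "x < 2 ^ n"
  let ?G = "foldr (gate_fun n) (clear_gates \<delta> v ks)"
  have ks: "set ks \<subseteq> {1..n} - {\<delta>}" and d: "\<delta> \<in> {1..n}" and n: "1 \<le> n" using assms by auto
  note bits = str_bit_clear_gates[OF assms(1) ks d]
  have less: "?G x < 2 ^ n" if "x < 2 ^ n" for x
    by (rule clear_gates_less) (use ks d that in auto)
  show "?G (flip_bit 0 x) = flip_bit 0 (?G x)"
    by (rule str_bit_eqI[where n = n])
      (use n x assms(2,3) d in \<open>auto simp: bits less flip_last_less str_bit_flip_last\<close>)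
qed

text \<open>
  A column whose first difference from \<open>c\<close> lies after \<open>\<delta>\<close> is not moved; any other column
  below \<open>c\<close> keeps its first difference from \<open>c\<close>. This is what conjugating with \<open>X\<close> is for.
\<close>

lemma clear_gates_preserves_less:
  assumes "distinct ks" "set ks \<subseteq> {\<delta><..<n}" "\<delta> \<in> {1..<n}" "c < 2 ^ n" "x < c"
  shows "foldr (gate_fun n) (clear_gates \<delta> (str_bit n c \<delta>) ks) x < c"
proof -
  let ?y = "foldr (gate_fun n) (clear_gates \<delta> (str_bit n c \<delta>) ks) x"
  have ks: "set ks \<subseteq> {1..n} - {\<delta>}" and d: "\<delta> \<in> {1..n}" using assms by auto
  note bits = str_bit_clear_gates[OF assms(1) ks d, of _ "str_bit n c \<delta>" x]
  have x: "x < 2 ^ n" using assms by simp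
  have y: "?y < 2 ^ n" by (rule clear_gates_less) (use ks d x in auto)
  obtain e where e: "e \<in> {1..n}" "\<not> str_bit n x e" "str_bit n c e"
      "\<forall>p\<in>{1..<e}. str_bit n x p = str_bit n c p"
    using assms(5) less_iff_first_difference[OF x assms(4)] by auto
  show ?thesis
  proof (cases "e \<le> \<delta>")
    case True
    then have "str_bit n ?y p = str_bit n x p" if "p \<in> {1..e}" for p
      using bits[of p] that e(1) assms(2) by auto
    then show ?thesis
      unfolding less_iff_first_difference[OF y assms(4)] using e by (intro bexI[of _ e]) auto
  next
    case False
    then have "str_bit n x \<delta> = str_bit n c \<delta>" using e(4) assms(3) by auto
    then have "?y = x" using bits x y by (intro str_bit_eqI[of _ n]) auto
    then show ?thesis using assms(5) by simp
  qed
qed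

subsection \<open>One step of the algorithm\<close>

lemma str_bit_half: "k \<in> {1..<n} \<Longrightarrow> str_bit (n - 1) (x div 2) k = str_bit n x k"
proof -
  assume "k \<in> {1..<n}"
  then have "n - k = Suc (n - 1 - k)" by auto
  then show ?thesis by (simp add: str_bit_def bit_Suc)
qed

lemma str_bit_double: "k \<in> {1..<n} \<Longrightarrow> str_bit (n - 1) i k = str_bit n (2 * i) k"
  using str_bit_half[of k n "2 * i"] by simp

lemma flip_bit_0_odd: "odd (flip_bit 0 x) \<longleftrightarrow> even x" for x :: nat
  using bit_flip_bit_iff[of 0 x 0] by (simp add: bit_0)

lemma paired_column_odd:
  assumes "paired n c r" "a < 2 ^ n"
  shows "odd (column n r a) \<longleftrightarrow> odd a"
proof -
  have p: "is_perm n r" and np: "normal_positions n r" using assms by (auto simp: paired_def)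
  show ?thesis
    using np column_less[OF p assms(2)] row_column[OF p assms(2)]
    unfolding normal_positions_def by (metis odd_iff_mod_2_eq_one)
qed

text \<open>Exactly one of \<alpha>, \<beta> disagrees with \<open>2 * i\<close> at \<delta>. The
  CNOT group changes only that one and removes all differences strictly between \<delta> and
  \<open>n\<close>. The final gate then flips \<delta> only in the odd column, so the last bit is
  the sole difference left.\<close>

lemma cons_stage:
  assumes r: "paired n (2 * i) r" and i: "i < 2 ^ (n - 1)" and n: "1 \<le> n"
    and m: "1 \<le> m" "m \<le> n" and him: "2 * i \<le> h n m"
    and a: "a < 2 ^ n"
    and ha: "h n m \<le> column n r a" and hb: "h n m \<le> column n r (flip_bit 0 a)"
  defines "r' \<equiv> apply_gates n (cons_gates n i m (column n r a) (column n r (flip_bit 0 a))) r"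
  shows "paired n (2 * i) r'" "column n r' (flip_bit 0 a) = flip_bit 0 (column n r' a)"
    "h n m \<le> column n r' a"
proof -
  define c \<alpha> \<beta> where "c = 2 * i" and "\<alpha> = column n r a" and "\<beta> = column n r (flip_bit 0 a)"
  define \<gamma> \<delta> where "\<gamma> = Bit_Operations.xor \<alpha> \<beta>" and "\<delta> = first_one n \<gamma>"
  have p: "is_perm n r" using r by (simp add: paired_def)
  have b: "flip_bit 0 a < 2 ^ n" using n a by (rule flip_last_less)
  have \<alpha>: "\<alpha> < 2 ^ n" and \<beta>: "\<beta> < 2 ^ n" using p a b by (auto simp: \<alpha>_def \<beta>_def column_less)
  have last: "str_bit n \<alpha> n \<noteq> str_bit n \<beta> n"
    using paired_column_odd[OF r a] paired_column_odd[OF r b]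
    by (auto simp: \<alpha>_def \<beta>_def str_bit_last flip_bit_0_odd)
  then have ne: "\<alpha> \<noteq> \<beta>" by auto
  have pow: "2 * 2 ^ (n - 1) = (2 :: nat) ^ n" using n by (cases n) auto
  have c: "c < 2 ^ n" unfolding c_def pow[symmetric] using i by simp
  note \<delta> = first_one_xor[OF \<alpha> \<beta> ne, folded \<gamma>_def \<delta>_def]
  have pre\<alpha>: "\<forall>p\<in>{1..<m}. str_bit n \<alpha> p" using h_le_iff[OF \<alpha> m] ha by (simp add: \<alpha>_def)
  have pre\<beta>: "\<forall>p\<in>{1..<m}. str_bit n \<beta> p" using h_le_iff[OF \<beta> m] hb by (simp add: \<beta>_def)
  \<comment> \<open>Both columns start with \<open>m - 1\<close> ones, so they cannot differ
    there.\<close>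
  have m\<delta>: "m \<le> \<delta>" using \<delta>(1,2) pre\<alpha> pre\<beta> by (meson atLeastAtMost_iff atLeastLessThan_iff not_le)
  have "paired n c r' \<and> column n r' (flip_bit 0 a) = flip_bit 0 (column n r' a) \<and> h n m \<le> column n r' a"
  proof (cases "\<delta> = n")
    case True
    then have "r' = r"
      by (simp add: r'_def cons_gates_def Let_def apply_gates_def \<delta>_def \<gamma>_def \<alpha>_def \<beta>_def)
    moreover have "\<beta> = flip_bit 0 \<alpha>"
      by (rule str_bit_eqI[where n = n])
        (use True \<delta> \<alpha> \<beta> last n in \<open>auto simp: str_bit_flip_last flip_last_less\<close>)
    ultimately show ?thesis using r ha by (simp add: \<alpha>_def \<beta>_def c_def)
  next
    case False
    define ks where "ks = filter (str_bit n \<gamma>) [\<delta> + 1..<n]"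
    define g where "g = CX ({1..m - 1} \<union> {n}) \<delta>"
    define G1 where "G1 = foldr (gate_fun n) (clear_gates \<delta> (str_bit n c \<delta>) ks)"
    define G2 where "G2 = gate_fun n g"
    have \<delta>n: "\<delta> \<in> {1..<n}" using \<delta>(1) False by auto
    have ks: "distinct ks" "set ks \<subseteq> {\<delta><..<n}" "set ks \<subseteq> {1..<n} - {\<delta>}" "set ks \<subseteq> {1..n} - {\<delta>}"
      by (auto simp: ks_def)
    have ks_iff: "q \<in> set ks \<longleftrightarrow> \<delta> < q \<and> q < n \<and> str_bit n \<alpha> q \<noteq> str_bit n \<beta> q" for q
      by (auto simp: ks_def \<gamma>_def str_bit_def bit_xor_iff)
    have gates: "cons_gates n i m \<alpha> \<beta> = clear_gates \<delta> (str_bit n c \<delta>) ks @ [g]"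
      using False str_bit_double[OF \<delta>n, of i]
      by (simp add: cons_gates_def Let_def clear_gates_def g_def ks_def c_def \<delta>_def \<gamma>_def)
    have r': "r' = (r \<circ> G1) \<circ> G2"
      unfolding r'_def \<alpha>_def[symmetric] \<beta>_def[symmetric] gates apply_gates_append
      by (simp add: apply_gates_eq G1_def G2_def)
    have G1: "parity_involution n G1"
      unfolding G1_def by (rule parity_involution_clear_gates[OF ks(1,3) \<delta>n])
    have G2: "parity_involution n G2"
      unfolding G2_def by (rule parity_involution_gate_fun) (use m m\<delta> \<delta>n in \<open>auto simp: g_def\<close>)
    \<comment> \<open>A column below \<open>c\<close> is below \<open>h n m\<close> and hence has a
      zero among the controls \<open>{1..m - 1}\<close>.\<close>
    have fix2: "G2 x = x" if "x < c" for x
    proof -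
      have "x < 2 ^ n" "\<not> h n m \<le> x" using that c him by (auto simp: c_def)
      then obtain q where "q \<in> {1..<m}" "\<not> str_bit n x q" using h_le_iff[OF _ m] by blast
      then show ?thesis by (auto simp: G2_def gate_fun_def g_def)
    qed
    have c1: "commutes_flip c G1"
      using commutes_flip_clear_gates[OF ks(1,3) \<delta>n] c unfolding commutes_flip_def G1_def by auto
    \<comment> \<open>Control \<open>n\<close> rules out the general lemma. Since \<open>c\<close>
      is even, flipping the last bit stays below \<open>c\<close>, where \<open>G2\<close> is the
      identity.\<close>
    have c2: "commutes_flip c G2"
    proof -
      have "flip_bit 0 x < c" if "x < c" for x
        using that by (cases "even x") (auto simp: c_def flip_bit_0 elim!: oddE evenE)
      then show ?thesis using fix2 unfolding commutes_flip_def by simp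
    qed
    have inv1: "paired n c (r \<circ> G1)"
      by (rule paired_comp[OF r[folded c_def] G1 c1])
        (use clear_gates_preserves_less[OF ks(1,2) \<delta>n c] in \<open>simp add: G1_def\<close>)
    have inv2: "paired n c r'"
      unfolding r' by (rule paired_comp[OF inv1 G2 c2]) (simp add: fix2)
    have p1: "is_perm n (r \<circ> G1)" using inv1 by (simp add: paired_def)
    have cola: "column n r' a = G2 (G1 \<alpha>)" and colb: "column n r' (flip_bit 0 a) = G2 (G1 \<beta>)"
      unfolding r' \<alpha>_def \<beta>_def column_comp[OF p1 G2 a] column_comp[OF p1 G2 b]
        column_comp[OF p G1 a] column_comp[OF p G1 b] by auto
    have bits1: "str_bit n (G1 x) q \<longleftrightarrow> str_bit n x q \<noteq> (q \<in> set ks \<and> str_bit n x \<delta> \<noteq> str_bit n c \<delta>)"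
      if "q \<in> {1..n}" for x q
      unfolding G1_def using str_bit_clear_gates[OF ks(1,4) \<delta>(1) that] .
    have pre: "\<forall>q\<in>{1..<m}. str_bit n (G1 x) q" if "\<forall>q\<in>{1..<m}. str_bit n x q" for x
      using that bits1[of _ x] m\<delta> \<delta>(1) by (auto simp: ks_iff)
    \<comment> \<open>The leading ones survive \<open>G1\<close> because it changes only positions
      after \<delta>, so the firing condition reduces to bit \<open>n\<close>.\<close>
    have bits2: "str_bit n (G2 (G1 x)) q \<longleftrightarrow> str_bit n (G1 x) q \<noteq> (q = \<delta> \<and> str_bit n x n)"
      if q: "q \<in> {1..n}" and "\<forall>q\<in>{1..<m}. str_bit n x q" for x q
    proof -
      have "(\<forall>k\<in>controls g. str_bit n (G1 x) k) \<longleftrightarrow> str_bit n x n"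
        using pre[OF that(2)] bits1[of n x] n by (auto simp: g_def ks_iff)
      then show ?thesis unfolding G2_def using str_bit_gate_fun[of g n q "G1 x"] q \<delta>(1)
        by (simp add: g_def)
    qed
    have less: "G2 (G1 x) < 2 ^ n" if "x < 2 ^ n" for x
      using G1 G2 that by (simp add: parity_involution_def)
    have "G2 (G1 \<beta>) = flip_bit 0 (G2 (G1 \<alpha>))"
    proof (rule str_bit_eqI)
      fix q assume q: "q \<in> {1..n}"
      show "str_bit n (G2 (G1 \<beta>)) q = str_bit n (flip_bit 0 (G2 (G1 \<alpha>))) q"
        unfolding str_bit_flip_last[OF q] bits2[OF q pre\<alpha>] bits2[OF q pre\<beta>] bits1[OF q] ks_iff
        using q \<delta>n \<delta>(2) \<delta>(3)[of q] last
        by (cases "q < \<delta>"; cases "q = n"; cases "q = \<delta>") auto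
    qed (use less \<alpha> \<beta> n flip_last_less in auto)
    moreover have "h n m \<le> G2 (G1 \<alpha>)"
      unfolding h_le_iff[OF less[OF \<alpha>] m]
      using bits2[OF _ pre\<alpha>] pre[OF pre\<alpha>] m m\<delta> by auto
    ultimately show ?thesis using inv2 by (simp add: cola colb)
  qed
  then show "paired n (2 * i) r'" "column n r' (flip_bit 0 a) = flip_bit 0 (column n r' a)"
    "h n m \<le> column n r' a" by (auto simp: c_def)
qed

lemma paired_extend:
  assumes "paired n (2 * i) r" "i < 2 ^ (n - 1)" "1 \<le> n" "a < 2 ^ n"
    "column n r (flip_bit 0 a) = flip_bit 0 (column n r a)" "column n r a div 2 = i"
  shows "paired n (2 * Suc i) r"
proof -
  have p: "is_perm n r" using assms by (simp add: paired_def)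
  have b: "flip_bit 0 a < 2 ^ n" using assms by (simp add: flip_last_less)
  let ?x = "column n r a"
  have ra: "r ?x = a" and rb: "r (flip_bit 0 ?x) = flip_bit 0 a"
    using row_column[OF p assms(4)] row_column[OF p b] assms(5) by auto
  have "r (flip_bit 0 x) = flip_bit 0 (r x)" if "x < 2 * Suc i" for x
  proof (cases "x < 2 * i")
    case True
    then show ?thesis using assms(1) by (simp add: paired_def commutes_flip_def)
  next
    case False
    have "flip_bit 0 ?x = (if even ?x then ?x + 1 else ?x - 1)" by (simp add: flip_bit_0)
    then have "x = ?x \<or> x = flip_bit 0 ?x" using assms(6) that False by (auto elim!: oddE evenE)
    then show ?thesis using ra rb by auto
  qed
  then show ?thesis using assms(1) by (simp add: paired_def commutes_flip_def)
qed

text \<open>After the CNOTs the column of \<open>a\<close> agrees with \<open>2 * i\<close> before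
  position \<open>n\<close> except for a one at \<delta>. All controls of the last gate are
  therefore satisfied and it clears that one. The partner follows since no gate reads or writes the
  last bit.\<close>

lemma alloc_stage:
  assumes r: "paired n (2 * i) r" and i: "i < 2 ^ (n - 1)" and n: "1 \<le> n"
    and a: "a < 2 ^ n" and ia: "2 * i \<le> column n r a"
    and colb: "column n r (flip_bit 0 a) = flip_bit 0 (column n r a)"
  shows "paired n (2 * Suc i) (apply_gates n (alloc_gates n i (column n r a div 2)) r)"
proof (cases "column n r a div 2 = i")
  case True
  then show ?thesis using paired_extend[OF r i n a colb] by (simp add: alloc_gates_def apply_gates_def)
next
  case False
  define c \<alpha> s where "c = 2 * i" and "\<alpha> = column n r a" and "s = column n r a div 2"
  define \<delta> where "\<delta> = first_one (n - 1) (Bit_Operations.xor s i)"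
  define r' where "r' = apply_gates n (alloc_gates n i s) r"
  have p: "is_perm n r" using r by (simp add: paired_def)
  have b: "flip_bit 0 a < 2 ^ n" using n a by (rule flip_last_less)
  have \<alpha>: "\<alpha> < 2 ^ n" using p a by (simp add: \<alpha>_def column_less)
  have pow: "2 * 2 ^ (n - 1) = (2 :: nat) ^ n" using n by (cases n) auto
  have c: "c < 2 ^ n" unfolding c_def pow[symmetric] using i by simp
  have s: "s < 2 ^ (n - 1)" using \<alpha> pow by (simp add: s_def \<alpha>_def)
  have "i < s" using False ia by (simp add: s_def)
  note \<delta> = first_one_xor[OF s i, folded \<delta>_def]
  have \<delta>n: "\<delta> \<in> {1..<n}" and d: "\<delta> \<in> {1..n - 1}" using \<delta>(1) \<open>i < s\<close> by auto
  have str_s: "str_bit (n - 1) s k = str_bit n \<alpha> k" if "k \<in> {1..<n}" for k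
    using str_bit_half[OF that] by (simp add: s_def \<alpha>_def)
  have str_i: "str_bit (n - 1) i k = str_bit n c k" if "k \<in> {1..<n}" for k
    using str_bit_double[OF that] by (simp add: c_def)
  have before: "str_bit n \<alpha> q = str_bit n c q" if "q \<in> {1..<\<delta>}" for q
    using \<delta>(3)[of q] \<open>i < s\<close> that str_s[of q] str_i[of q] \<delta>n by auto
  have "\<not> (\<not> str_bit (n - 1) s \<delta> \<and> str_bit (n - 1) i \<delta>)"
    using less_iff_first_difference[OF s i] \<open>i < s\<close> d \<delta>(3) by fastforce
  \<comment> \<open>Since \<open>i < s\<close>, the first difference is a one of \<open>s\<close>
    and a zero of \<open>i\<close>.\<close>
  then have at: "str_bit n \<alpha> \<delta>" "\<not> str_bit n c \<delta>"
    using \<delta>(2) \<open>i < s\<close> str_s[OF \<delta>n] str_i[OF \<delta>n] by auto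
  define ks where "ks = filter (str_bit (n - 1) (Bit_Operations.xor s i)) [\<delta> + 1..<n]"
  define g where "g = CX {k. \<delta> < k \<and> k \<le> n - 1 \<and> str_bit (n - 1) i k} \<delta>"
  define G1 where "G1 = foldr (gate_fun n) (clear_gates \<delta> (str_bit n c \<delta>) ks)"
  define G2 where "G2 = gate_fun n g"
  have ks: "distinct ks" "set ks \<subseteq> {\<delta><..<n}" "set ks \<subseteq> {1..<n} - {\<delta>}" "set ks \<subseteq> {1..n} - {\<delta>}"
    by (auto simp: ks_def)
  have mem: "q \<in> set ks \<longleftrightarrow> \<delta> < q \<and> q < n \<and> str_bit (n - 1) s q \<noteq> str_bit (n - 1) i q" for q
    by (auto simp: ks_def str_bit_def bit_xor_iff)
  have ks_iff: "q \<in> set ks \<longleftrightarrow> \<delta> < q \<and> q < n \<and> str_bit n \<alpha> q \<noteq> str_bit n c q" for q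
    using mem[of q] str_s[of q] str_i[of q] by auto
  have ctrl: "controls g = {k. \<delta> < k \<and> k < n \<and> str_bit n c k}" and tgt: "target g = \<delta>"
    using str_i \<delta>n by (auto simp: g_def)
  \<comment> \<open>ALLOC has no \<open>X\<close> gates, which matches \<open>clear_gates\<close>
    because bit \<delta> of \<open>c\<close> is zero.\<close>
  have gates: "alloc_gates n i s = clear_gates \<delta> (str_bit n c \<delta>) ks @ [g]"
    using \<open>i < s\<close> at by (simp add: alloc_gates_def Let_def clear_gates_def g_def ks_def \<delta>_def)
  have r': "r' = (r \<circ> G1) \<circ> G2"
    unfolding r'_def gates apply_gates_append by (simp add: apply_gates_eq G1_def G2_def)
  have G1: "parity_involution n G1"
    unfolding G1_def by (rule parity_involution_clear_gates[OF ks(1,3) \<delta>n])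
  have G2: "parity_involution n G2"
    unfolding G2_def by (rule parity_involution_gate_fun) (use \<delta>n in \<open>auto simp: ctrl tgt\<close>)
  have f1: "commutes_flip (2 ^ n) G1"
    unfolding G1_def by (rule commutes_flip_clear_gates[OF ks(1,3) \<delta>n])
  have f2: "commutes_flip (2 ^ n) G2"
    unfolding G2_def by (rule commutes_flip_gate_fun) (use \<delta>n in \<open>auto simp: ctrl tgt\<close>)
  have c1: "commutes_flip c G1" and c2: "commutes_flip c G2"
    using f1 f2 c by (auto simp: commutes_flip_def)
  have bits1: "str_bit n (G1 x) q \<longleftrightarrow> str_bit n x q \<noteq> (q \<in> set ks \<and> str_bit n x \<delta>)"
    if "q \<in> {1..n}" for x q
    unfolding G1_def using str_bit_clear_gates[OF ks(1,4) _ that] \<delta>n at(2) by auto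
  have bits2: "str_bit n (G2 x) q \<longleftrightarrow>
      str_bit n x q \<noteq> (q = \<delta> \<and> (\<forall>k. \<delta> < k \<and> k < n \<and> str_bit n c k \<longrightarrow> str_bit n x k))"
    if "q \<in> {1..n}" for x q
    unfolding G2_def using str_bit_gate_fun[of g n q x] \<delta>n that by (auto simp: ctrl tgt)
  \<comment> \<open>The first difference \<open>e\<close> is a one of \<open>c\<close>, so it is
    neither \<delta> nor \<open>n\<close>. Before \<delta> it is untouched; after \<delta> it is a
    control at which \<open>x\<close> has a zero, so the gate does not fire.\<close>
  have less2: "G2 x < c" if xc: "x < c" for x
  proof -
    have x: "x < 2 ^ n" and y: "G2 x < 2 ^ n" using xc c G2 by (auto simp: parity_involution_def)
    obtain e where e: "e \<in> {1..n}" "\<not> str_bit n x e" "str_bit n c e"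
        "\<forall>p\<in>{1..<e}. str_bit n x p = str_bit n c p"
      using xc less_iff_first_difference[OF x c] by auto
    have "e \<noteq> \<delta>" using e(3) at(2) by auto
    have "e \<noteq> n" using e(3) by (auto simp: str_bit_last c_def)
    show ?thesis
    proof (cases "e < \<delta>")
      case True
      then have "str_bit n (G2 x) q = str_bit n x q" if "q \<in> {1..e}" for q
        using bits2[of q x] that e(1) by auto
      then show ?thesis
        unfolding less_iff_first_difference[OF y c] using e by (intro bexI[of _ e]) auto
    next
      case False
      then have "e \<in> controls g" using \<open>e \<noteq> \<delta>\<close> \<open>e \<noteq> n\<close> e(1,3) by (auto simp: ctrl)
      then have "G2 x = x" using e(2) by (auto simp: G2_def gate_fun_def)
      then show ?thesis using xc by simp
    qed
  qed
  have inv1: "paired n c (r \<circ> G1)"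
    by (rule paired_comp[OF r[folded c_def] G1 c1])
      (use clear_gates_preserves_less[OF ks(1,2) \<delta>n c] in \<open>simp add: G1_def\<close>)
  have inv2: "paired n c r'"
    unfolding r' using inv1 G2 c2 less2 by (rule paired_comp)
  have p1: "is_perm n (r \<circ> G1)" using inv1 by (simp add: paired_def)
  have cola: "column n r' a = G2 (G1 \<alpha>)"
    unfolding r' \<alpha>_def column_comp[OF p1 G2 a] column_comp[OF p G1 a] ..
  have "G1 \<alpha> < 2 ^ n" using G1 \<alpha> by (simp add: parity_involution_def)
  then have "column n r' (flip_bit 0 a) = flip_bit 0 (column n r' a)"
    unfolding cola unfolding r' column_comp[OF p1 G2 b] column_comp[OF p G1 b] colb
    using f1 f2 \<alpha> by (simp add: commutes_flip_def \<alpha>_def)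
  moreover have "column n r' a div 2 = i"
  proof (rule str_bit_eqI)
    have "G2 (G1 \<alpha>) < 2 ^ n" using G2 \<open>G1 \<alpha> < 2 ^ n\<close> by (simp add: parity_involution_def)
    then show "column n r' a div 2 < 2 ^ (n - 1)" using pow by (simp add: cola)
    show "i < 2 ^ (n - 1)" by fact
    fix q assume "q \<in> {1..n - 1}"
    then have q: "q \<in> {1..<n}" "q \<in> {1..n}" by auto
    have G1\<alpha>: "str_bit n (G1 \<alpha>) k \<longleftrightarrow> str_bit n c k \<or> k = \<delta>" if "k \<in> {1..<n}" for k
      using bits1[of k \<alpha>] before[of k] at that unfolding ks_iff by (cases k \<delta> rule: linorder_cases) auto
    have "\<forall>k. \<delta> < k \<and> k < n \<and> str_bit n c k \<longrightarrow> str_bit n (G1 \<alpha>) k"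
      using G1\<alpha> by auto
    then have "str_bit n (G2 (G1 \<alpha>)) q = str_bit n c q"
      using bits2[OF q(2), of "G1 \<alpha>"] G1\<alpha>[OF q(1)] at(2) by auto
    then show "str_bit (n - 1) (column n r' a div 2) q = str_bit (n - 1) i q"
      unfolding str_bit_half[OF q(1)] str_i[OF q(1)] cola .
  qed
  ultimately have "paired n (2 * Suc i) r'"
    using paired_extend[OF inv2[unfolded c_def] i n a] by blast
  then show ?thesis by (simp add: r'_def s_def)
qed

section \<open>The thresholds \<open>h\<close> and the values of \<open>m_of\<close>\<close>

lemma h_eq_double: "1 \<le> m \<Longrightarrow> m \<le> n \<Longrightarrow> h n m = 2 * (2 ^ (n - 1) - 2 ^ (n - m))"
proof -
  assume m: "1 \<le> m" "m \<le> n"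
  then have "n = Suc (n - 1)" "n + 1 - m = Suc (n - m)" by auto
  then have "(2::nat) ^ n = 2 * 2 ^ (n - 1)" "(2::nat) ^ (n + 1 - m) = 2 * 2 ^ (n - m)"
    by (metis power_Suc)+
  then show ?thesis unfolding h_def by simp
qed

lemma h_mono: "m \<le> m' \<Longrightarrow> h n m \<le> h n m'"
  unfolding h_def by (intro diff_le_mono2 power_increasing) auto

text \<open>The value \<open>m = n\<close> always qualifies because \<open>h n n\<close> is the
  first column of the last block.\<close>

lemma m_of_bounds:
  assumes "1 \<le> n" "i < 2 ^ (n - 1)"
  shows "1 \<le> m_of n i" "m_of n i \<le> n" "2 * i \<le> h n (m_of n i)"
    "2 \<le> m_of n i \<Longrightarrow> h n (m_of n i - 1) < 2 * i"
proof -
  have n: "0 < n \<and> 2 * i \<le> h n n" using assms by (auto simp: h_eq_double)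
  show "1 \<le> m_of n i" "2 * i \<le> h n (m_of n i)"
    using LeastI[of "\<lambda>m. 0 < m \<and> 2 * i \<le> h n m", OF n] by (auto simp: m_of_def)
  show "m_of n i \<le> n" unfolding m_of_def using n by (rule Least_le)
  assume "2 \<le> m_of n i"
  then show "h n (m_of n i - 1) < 2 * i"
    using not_less_Least[of "m_of n i - 1" "\<lambda>m. 0 < m \<and> 2 * i \<le> h n m"]
    by (auto simp: m_of_def)
qed

lemma m_of_eqI:
  assumes "1 \<le> m" "h n m < 2 * i" "2 * i \<le> h n (Suc m)"
  shows "m_of n i = Suc m"
  unfolding m_of_def
proof (rule Least_equality)
  fix m' assume "0 < m' \<and> 2 * i \<le> h n m'"
  then show "Suc m \<le> m'" using assms(2) h_mono[of m' m n] by (meson le_trans not_le not_less_eq_eq)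
qed (use assms in auto)

text \<open>The value 1 occurs only at \<open>i = 0\<close>; a value \<open>m\<close> from 2 to
  \<open>n\<close> occurs between two consecutive halved thresholds, that is
  \<open>2 ^ (n - m)\<close> times.\<close>

lemma sum_m_of:
  fixes F :: "nat \<Rightarrow> nat"
  assumes "1 \<le> n"
  shows "(\<Sum>i<2 ^ (n - 1). F (m_of n i)) = F 1 + (\<Sum>m = 2..n. F m * 2 ^ (n - m))"
proof -
  define k :: "nat \<Rightarrow> nat" where "k m = 2 ^ (n - 1) - 2 ^ (n - m)" for m
  have hk: "h n m = 2 * k m" if "1 \<le> m" "m \<le> n" for m using that by (simp add: h_eq_double k_def)
  \<comment> \<open>Induction over thresholds; at \<open>m = n\<close> the bound \<open>k n\<close>
    is the last block index.\<close>
  have "(\<Sum>i\<le>k m. F (m_of n i)) = F 1 + (\<Sum>m = 2..m. F m * 2 ^ (n - m))"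
    if "1 \<le> m" "m \<le> n" for m
    using that
  proof (induction m rule: nat_induct_at_least)
    case base
    have "m_of n 0 = 1" unfolding m_of_def by (rule Least_equality) auto
    then show ?case by (simp add: k_def)
  next
    case (Suc m)
    have "n - m = Suc (n - Suc m)" using Suc.prems by auto
    then have pw: "(2::nat) ^ (n - m) = 2 * 2 ^ (n - Suc m)" by simp
    have "(2::nat) ^ (n - m) \<le> 2 ^ (n - 1)" using Suc.hyps by (intro power_increasing) auto
    then have kk: "k (Suc m) = k m + 2 ^ (n - Suc m)" using pw by (simp add: k_def)
    have "(\<Sum>i\<le>k (Suc m). F (m_of n i)) =
        (\<Sum>i\<le>k m. F (m_of n i)) + (\<Sum>i\<in>{k m<..k (Suc m)}. F (m_of n i))"
      by (subst sum.union_disjoint[symmetric]) (auto intro!: sum.cong simp: kk)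
    also have "(\<Sum>i\<in>{k m<..k (Suc m)}. F (m_of n i)) = (\<Sum>i\<in>{k m<..k (Suc m)}. F (Suc m))"
    proof (rule sum.cong[OF refl])
      fix i assume "i \<in> {k m<..k (Suc m)}"
      then show "F (m_of n i) = F (Suc m)"
        using Suc.hyps Suc.prems by (subst m_of_eqI[of m]) (auto simp: hk)
    qed
    also have "\<dots> = F (Suc m) * 2 ^ (n - Suc m)" by (simp add: kk)
    finally show ?case using Suc by simp
  qed
  from this[of n] have "(\<Sum>i\<le>2 ^ (n - 1) - 1. F (m_of n i)) = F 1 + (\<Sum>m = 2..n. F m * 2 ^ (n - m))"
    using assms by (simp add: k_def)
  moreover have "{..2 ^ (n - 1) - 1} = {..<2 ^ (n - 1) :: nat}"
  proof -
    have "Suc (2 ^ (n - 1) - 1) = 2 ^ (n - 1)" by simp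
    then show ?thesis by (metis lessThan_Suc_atMost)
  qed
  ultimately show ?thesis by simp
qed

text \<open>
  If the scan failed, the partners of all rows in columns \<open>\<ge> h n m\<close> would lie in the
  columns between \<open>2 * i\<close> and \<open>h n m\<close>, and there are too few of those.
\<close>

lemma pick_succeeds:
  assumes r: "paired n (2 * i) r" and n: "1 \<le> n" and i: "i < 2 ^ (n - 1)"
  defines "m \<equiv> m_of n i"
  obtains a where "pick n m r = (a, flip_bit 0 a)" "a < 2 ^ n"
    "h n m \<le> column n r a" "h n m \<le> column n r (flip_bit 0 a)"
proof -
  note m = m_of_bounds[OF n i, folded m_def]
  have p: "is_perm n r" using r by (simp add: paired_def)
  have inj: "inj_on r {..<2 ^ n}" using p by (simp add: is_perm_def bij_betw_def)
  let ?P = "\<lambda>j. h n m \<le> j \<and> j \<le> 2 ^ n - 2 \<and> (\<exists>t. j < t \<and> t < 2 ^ n \<and> flip_bit 0 (r j) = r t)"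
  define \<pi> where "\<pi> x = column n r (flip_bit 0 (r x))" for x
  have frow: "flip_bit 0 (r x) < 2 ^ n" if "x < 2 ^ n" for x
    using that p n by (simp add: flip_last_less row_less)
  have \<pi>_less: "\<pi> x < 2 ^ n" and r\<pi>: "r (\<pi> x) = flip_bit 0 (r x)" if "x < 2 ^ n" for x
    using frow[OF that] p by (auto simp: \<pi>_def column_less row_column)
  have "\<exists>j. ?P j"
  proof (rule ccontr)
    assume none: "\<not> (\<exists>j. ?P j)"
    have sub: "\<pi> ` {h n m..<2 ^ n} \<subseteq> {2 * i..<h n m}"
    proof (intro image_subsetI)
      fix x assume x: "x \<in> {h n m..<2 ^ n}"
      have l: "\<pi> x < 2 ^ n" and e: "r (\<pi> x) = flip_bit 0 (r x)" using x \<pi>_less r\<pi> by auto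
      have ne: "\<pi> x \<noteq> x" using e flip_bit_0_odd[of "r x"] by auto
      \<comment> \<open>Otherwise the smaller of \<open>x\<close> and its partner column would stop
        the scan.\<close>
      have "\<not> h n m \<le> \<pi> x"
      proof
        assume ge: "h n m \<le> \<pi> x"
        show False
        proof (cases "x < \<pi> x")
          case True
          then have "?P x" using x l e by (auto intro!: exI[of _ "\<pi> x"])
          then show False using none by blast
        next
          case False
          then have "?P (\<pi> x)" using x l e ge ne by (auto intro!: exI[of _ x])
          then show False using none by blast
        qed
      qed
      \<comment> \<open>A partner in a finished block would have row \<open>r x\<close> next to it,
        forcing \<open>x\<close> below \<open>2 * i\<close> by injectivity.\<close>
      moreover have "2 * i \<le> \<pi> x"
      proof (rule ccontr)
        assume "\<not> 2 * i \<le> \<pi> x"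
        then have lt: "\<pi> x < 2 * i" by simp
        then have "r (flip_bit 0 (\<pi> x)) = r x"
          using r e by (simp add: paired_def commutes_flip_def)
        then have "flip_bit 0 (\<pi> x) = x"
          using inj x l n flip_last_less[OF n l] by (auto simp: inj_on_def)
        moreover have "flip_bit 0 (\<pi> x) < 2 * i"
          using lt by (cases "even (\<pi> x)") (auto simp: flip_bit_0 elim!: oddE evenE)
        ultimately show False using x m(3) by simp
      qed
      ultimately show "\<pi> x \<in> {2 * i..<h n m}" by simp
    qed
    have "inj_on \<pi> {h n m..<2 ^ n}"
    proof (rule inj_onI)
      fix x y assume xy: "x \<in> {h n m..<2 ^ n}" "y \<in> {h n m..<2 ^ n}" "\<pi> x = \<pi> y"
      then have "flip_bit 0 (r x) = flip_bit 0 (r y)" using r\<pi>[of x] r\<pi>[of y] by simp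
      then have "r x = r y" by (metis flip_bit_0_involutory)
      then show "x = y" using inj xy by (auto simp: inj_on_def)
    qed
    then have "card {h n m..<2 ^ n} \<le> card {2 * i..<h n m}"
      using sub by (metis card_image card_mono finite_atLeastLessThan)
    then have le: "2 ^ n - h n m \<le> h n m - 2 * i" by simp
    have pos: "0 < 2 ^ n - h n m" by (simp add: h_def)
    show False
    proof (cases "m = 1")
      case True
      then show False using le pos by (simp add: h_def)
    next
      case False
      then have m2: "2 \<le> m" using m(1) by simp
      have "n + 1 - (m - 1) = Suc (n + 1 - m)" using m(2) m2 by auto
      then have pw: "(2::nat) ^ (n + 1 - (m - 1)) = 2 * 2 ^ (n + 1 - m)" by simp
      have "(2::nat) ^ (n + 1 - (m - 1)) \<le> 2 ^ n" using m2 by (intro power_increasing) auto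
      \<comment> \<open>The columns from \<open>h n m\<close> on are as many as those from
        \<open>h n (m - 1)\<close> up to \<open>h n m\<close>. Minimality of \<open>m\<close> gives
        \<open>h n (m - 1) < 2 * i\<close>, so the available columns are strictly fewer.\<close>
      then have "2 ^ n - h n m = h n m - h n (m - 1)" "h n m \<le> 2 ^ n"
        unfolding h_def pw by linarith+
      then show False using le pos m(4)[OF m2] by simp
    qed
  qed
  define j where "j = (LEAST j. ?P j)"
  have "?P j" unfolding j_def using \<open>\<exists>j. ?P j\<close> by (rule LeastI_ex)
  then obtain t where j: "h n m \<le> j" "j < t" "t < 2 ^ n" "flip_bit 0 (r j) = r t" by auto
  show thesis
  proof (rule that[of "r j"])
    show "pick n m r = (r j, flip_bit 0 (r j))" unfolding pick_def j_def by (simp add: Let_def)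
    show "r j < 2 ^ n" using j p by (simp add: row_less)
    have "column n r (r j) = j" "column n r (r t) = t" using p j by (auto intro!: column_eqI)
    then show "h n m \<le> column n r (r j)" "h n m \<le> column n r (flip_bit 0 (r j))"
      using j by auto
  qed
qed

subsection \<open>Counting\<close>

text \<open>The gate cost as a function of the number of controls, so that it can be compared
  monotonically and summed over bit patterns.\<close>

definition control_cost :: "nat \<Rightarrow> nat" where
  "control_cost k = (if 2 \<le> k then 2 * k - 3 else 0)"

lemma toffoli_cost_CX: "toffoli_cost (CX I k) = control_cost (card I)"
  by (simp add: toffoli_cost_def control_cost_def Let_def)

lemma control_cost_mono: "k \<le> l \<Longrightarrow> control_cost k \<le> control_cost l"
  by (auto simp: control_cost_def)

lemma toffoli_count_append: "toffoli_count (gs @ hs) = toffoli_count gs + toffoli_count hs"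
  by (simp add: toffoli_count_def)

lemma toffoli_count_CNOTs: "toffoli_count (map (\<lambda>k. CX {\<delta>} k) ks) = 0"
  by (induction ks) (auto simp: toffoli_count_def toffoli_cost_CX control_cost_def)

text \<open>Only the last gate has more than one control when \<open>m\<close> is at least 2, and it
  has \<open>m\<close> of them. At \<open>m = n\<close> the first difference is forced to be
  \<open>n\<close>, so no gate is emitted.\<close>

lemma toffoli_count_cons_gates:
  assumes "\<alpha> < 2 ^ n" "\<beta> < 2 ^ n" "\<alpha> \<noteq> \<beta>" "1 \<le> m" "m \<le> n" "h n m \<le> \<alpha>" "h n m \<le> \<beta>"
  shows "toffoli_count (cons_gates n i m \<alpha> \<beta>) \<le> (if m < n then control_cost m else 0)"
proof -
  define \<delta> where "\<delta> = first_one n (Bit_Operations.xor \<alpha> \<beta>)"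
  note \<delta> = first_one_xor[OF assms(1-3), folded \<delta>_def]
  have "\<forall>p\<in>{1..<m}. str_bit n \<alpha> p" "\<forall>p\<in>{1..<m}. str_bit n \<beta> p"
    using h_le_iff assms by auto
  then have "m \<le> \<delta>" using \<delta>(1,2) by (meson atLeastAtMost_iff atLeastLessThan_iff not_le)
  show ?thesis
  proof (cases "\<delta> = n")
    case True
    then show ?thesis by (simp add: cons_gates_def Let_def \<delta>_def toffoli_count_def)
  next
    case False
    then have mn: "m < n" using \<open>m \<le> \<delta>\<close> \<delta>(1) by auto
    define xs where "xs = (if str_bit (n - 1) i \<delta> then [CX {} \<delta>] else [])"
    have "{1..m - 1} \<union> {n} = insert n {1..m - 1}" "n \<notin> {1..m - 1}" using mn by auto
    then have "card ({1..m - 1} \<union> {n}) = m" using assms(4) by simp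
    then have last: "toffoli_count [CX ({1..m - 1} \<union> {n}) \<delta>] = control_cost m"
      by (simp add: toffoli_count_def toffoli_cost_CX)
    have "toffoli_count xs = 0"
      by (simp add: xs_def toffoli_count_def toffoli_cost_CX control_cost_def)
    moreover have "cons_gates n i m \<alpha> \<beta> = xs @
        map (\<lambda>k. CX {\<delta>} k) (filter (str_bit n (Bit_Operations.xor \<alpha> \<beta>)) [\<delta> + 1..<n]) @ xs @
        [CX ({1..m - 1} \<union> {n}) \<delta>]"
      using False by (simp add: cons_gates_def Let_def \<delta>_def xs_def)
    ultimately show ?thesis using mn
      by (simp only: toffoli_count_append toffoli_count_CNOTs last) simp
  qed
qed

text \<open>
  Bounds the cost of moving a block to position \<open>i\<close>: the target is a zero of the \<open>l\<close>-bit string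
  \<open>i\<close>, so at worst its first zero, and the controls are the ones after it.
\<close>

fun alloc_bound :: "nat \<Rightarrow> nat \<Rightarrow> nat" where
  "alloc_bound 0 i = 0"
| "alloc_bound (Suc l) i =
    (if i < 2 ^ l then control_cost (card {e. e < l \<and> bit i e}) else alloc_bound l (i - 2 ^ l))"

lemma bit_add_power:
  fixes i :: nat assumes "i < 2 ^ l" shows "bit (i + 2 ^ l) e \<longleftrightarrow> bit i e \<or> e = l"
proof -
  have "i + 2 ^ l = Bit_Operations.or i (2 ^ l)"
  proof (rule disjunctive_add_eq_or)
    show "Bit_Operations.and i (2 ^ l) = 0"
      by (rule bit_eqI) (use assms in \<open>auto simp: bit_and_iff bit_exp_iff less_power_iff_bit\<close>)
  qed
  then show ?thesis by (auto simp: bit_or_iff bit_exp_iff)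
qed

text \<open>Bits count from the least significant end here, so the first zero of the string is the
  highest one and has the most ones below it. The induction strips leading ones, which lie above
  \<open>d\<close> and are not counted.\<close>

lemma control_cost_le_alloc_bound:
  assumes "d < l" "\<not> bit i d" "i < 2 ^ l"
  shows "control_cost (card {e. e < d \<and> bit i e}) \<le> alloc_bound l i"
  using assms
proof (induction l arbitrary: i)
  case (Suc l)
  show ?case
  proof (cases "i < 2 ^ l")
    case True
    have "card {e. e < d \<and> bit i e} \<le> card {e. e < l \<and> bit i e}"
      using Suc.prems(1) by (intro card_mono) auto
    then show ?thesis using True by (simp add: control_cost_mono)
  next
    case False
    define j where "j = i - 2 ^ l"
    have i: "i = j + 2 ^ l" and j: "j < 2 ^ l" using False Suc.prems(3) by (auto simp: j_def)
    note bits = bit_add_power[OF j, folded i]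
    have d: "d < l" "\<not> bit j d" using Suc.prems(1,2) bits[of d] bits[of l] by (auto simp: less_Suc_eq)
    then have "{e. e < d \<and> bit i e} = {e. e < d \<and> bit j e}" by (auto simp: bits)
    then show ?thesis using Suc.IH[OF d j] False by (simp add: j_def)
  qed
qed simp

lemma toffoli_count_alloc_gates:
  assumes "i \<le> s" "s < 2 ^ (n - 1)"
  shows "toffoli_count (alloc_gates n i s) \<le> alloc_bound (n - 1) i"
proof (cases "s = i")
  case True
  then show ?thesis by (simp add: alloc_gates_def Let_def toffoli_count_def)
next
  case False
  define l where "l = n - 1"
  define \<delta> where "\<delta> = first_one l (Bit_Operations.xor s i)"
  have i: "i < 2 ^ l" and s: "s < 2 ^ l" using assms by (auto simp: l_def)
  note \<delta> = first_one_xor[OF s i False, folded \<delta>_def]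
  have "\<not> (\<not> str_bit l s \<delta> \<and> str_bit l i \<delta>)"
    using less_iff_first_difference[OF s i] assms(1) \<delta>(1,3) by fastforce
  then have "\<not> bit i (l - \<delta>)" using \<delta>(2) by (auto simp: str_bit_def)
  moreover have "l - \<delta> < l" using \<delta>(1) by auto
  ultimately have bound: "control_cost (card {e. e < l - \<delta> \<and> bit i e}) \<le> alloc_bound l i"
    using i by (intro control_cost_le_alloc_bound)
  \<comment> \<open>Translates string positions after \<delta> into library bits below
    \<open>l - \<delta>\<close>.\<close>
  have "bij_betw (\<lambda>k. l - k) {k. \<delta> < k \<and> k \<le> l \<and> str_bit l i k} {e. e < l - \<delta> \<and> bit i e}"
    by (rule bij_betw_byWitness[where f' = "\<lambda>e. l - e"]) (use \<delta>(1) in \<open>auto simp: str_bit_def\<close>)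
  then have "card {k. \<delta> < k \<and> k \<le> l \<and> str_bit l i k} = card {e. e < l - \<delta> \<and> bit i e}"
    by (rule bij_betw_same_card)
  then have "toffoli_count [CX {k. \<delta> < k \<and> k \<le> l \<and> str_bit l i k} \<delta>] \<le> alloc_bound l i"
    using bound by (simp add: toffoli_count_def toffoli_cost_CX)
  moreover have "alloc_gates n i s =
      map (\<lambda>k. CX {\<delta>} k) (filter (str_bit l (Bit_Operations.xor s i)) [\<delta> + 1..<n])
      @ [CX {k. \<delta> < k \<and> k \<le> l \<and> str_bit l i k} \<delta>]"
    using False by (simp add: alloc_gates_def Let_def \<delta>_def l_def)
  ultimately show ?thesis
    by (simp only: toffoli_count_append toffoli_count_CNOTs l_def add_0)
qed

section \<open>Sums over all bit patterns of a given length\<close>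

lemma sum_power_Suc_split:
  fixes F :: "nat \<Rightarrow> nat"
  shows "(\<Sum>i<2 ^ Suc l. F i) = (\<Sum>i<2 ^ l. F i) + (\<Sum>i<2 ^ l. F (i + 2 ^ l))"
proof -
  have "(\<Sum>i<2 ^ Suc l. F i) = (\<Sum>i<2 ^ l. F i) + sum F {2 ^ l..<2 ^ l + 2 ^ l}"
    by (simp add: lessThan_atLeast0 sum.atLeastLessThan_concat mult_2)
  then show ?thesis
    using sum.shift_bounds_nat_ivl[of F 0 "2 ^ l" "2 ^ l"] by (simp add: lessThan_atLeast0)
qed

text \<open>There are \<open>l choose k\<close> strings with \<open>k\<close> ones. Splitting on the
  top bit gives Pascal's rule; \<open>F\<close> is general because a set top bit shifts its argument
  by one.\<close>

lemma sum_card_bits: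
  fixes F :: "nat \<Rightarrow> nat"
  shows "(\<Sum>i<2 ^ l. F (card {e. e < l \<and> bit (i :: nat) e})) = (\<Sum>k\<le>l. F k * (l choose k))"
proof (induction l arbitrary: F)
  case (Suc l)
  have low: "{e. e < Suc l \<and> bit i e} = {e. e < l \<and> bit i e}" if "i < 2 ^ l" for i :: nat
    using that by (auto simp: less_Suc_eq less_power_iff_bit)
  have high: "card {e. e < Suc l \<and> bit (i + 2 ^ l) e} = Suc (card {e. e < l \<and> bit i e})"
    if "i < 2 ^ l" for i :: nat
  proof -
    have "{e. e < Suc l \<and> bit (i + 2 ^ l) e} = insert l {e. e < l \<and> bit i e}"
      using that by (auto simp: bit_add_power less_Suc_eq)
    then show ?thesis by simp
  qed
  have "(\<Sum>i<2 ^ Suc l. F (card {e. e < Suc l \<and> bit (i :: nat) e})) =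
      (\<Sum>k\<le>l. F k * (l choose k)) + (\<Sum>k\<le>l. F (Suc k) * (l choose k))"
    unfolding sum_power_Suc_split Suc[symmetric]
    by (intro arg_cong2[of _ _ _ _ "(+)"] sum.cong) (auto simp only: low high lessThan_iff)
  \<comment> \<open>The added summand vanishes since \<open>l choose Suc l\<close> is zero.\<close>
  also have "(\<Sum>k\<le>l. F k * (l choose k)) = (\<Sum>k\<le>Suc l. F k * (l choose k))"
    by simp
  also have "\<dots> = F 0 + (\<Sum>k\<le>l. F (Suc k) * (l choose Suc k))"
    by (subst sum.atMost_Suc_shift) simp
  also have "\<dots> + (\<Sum>k\<le>l. F (Suc k) * (l choose k)) = F 0 + (\<Sum>k\<le>l. F (Suc k) * (Suc l choose Suc k))"
    by (simp add: sum.distrib[symmetric] algebra_simps)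
  also have "\<dots> = (\<Sum>k\<le>Suc l. F k * (Suc l choose k))"
    unfolding sum.atMost_Suc_shift by simp
  finally show ?case .
qed simp

text \<open>A first zero followed by \<open>t\<close> free bits contributes \<open>W t\<close>, for
  each \<open>t < n - 1\<close>; the string of ones contributes nothing.\<close>

lemma sum_alloc_bound:
  assumes "3 \<le> n"
  shows "(\<Sum>i<2 ^ (n - 1). alloc_bound (n - 1) i) = N_a n"
proof -
  define W where "W l = (\<Sum>k = 2..l. (2 * k - 3) * (l choose k))" for l
  have W: "(\<Sum>k\<le>l. control_cost k * (l choose k)) = W l" for l
    unfolding W_def by (rule sum.mono_neutral_cong_right) (auto simp: control_cost_def)
  have S: "(\<Sum>i<2 ^ l. alloc_bound l i) = (\<Sum>t<l. W t)" for l
  proof (induction l)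
    case (Suc l)
    have "(\<Sum>i<2 ^ Suc l. alloc_bound (Suc l) i) =
        (\<Sum>i<2 ^ l. control_cost (card {e. e < l \<and> bit (i :: nat) e})) + (\<Sum>i<2 ^ l. alloc_bound l i)"
      unfolding sum_power_Suc_split by simp
    then show ?case unfolding sum_card_bits W Suc by simp
  qed simp
  \<comment> \<open>\<open>W 0\<close> and \<open>W 1\<close> are empty sums; the substitution
    \<open>t = n - j\<close> then gives the form of \<open>N_a\<close>.\<close>
  have "(\<Sum>t<n - 1. W t) = (\<Sum>t = 2..n - 2. W t)"
    by (rule sum.mono_neutral_right) (use assms in \<open>auto simp: W_def\<close>)
  also have "\<dots> = (\<Sum>j = 2..n - 2. W (n - j))"
    using assms by (subst sum.atLeastAtMost_rev) (auto intro!: sum.cong arg_cong[of _ _ W])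
  finally show ?thesis unfolding S by (simp add: N_a_def W_def)
qed

text \<open>Pairedness and cost are carried together: the bounds for a step rely on a successful
  scan, which pairedness guarantees.\<close>

lemma A_red_prefix:
  assumes n: "3 \<le> n" and P: "is_perm n P" "normal_positions n P"
    and N: "N \<le> 2 ^ (n - 1)"
    and "fold (red_step n) [0..<N] ([], P) = (R, Q)"
  shows "paired n (2 * N) Q \<and> toffoli_count R \<le>
    (\<Sum>i<N. (if m_of n i < n then control_cost (m_of n i) else 0) + alloc_bound (n - 1) i)"
  using N assms(5)
proof (induction N arbitrary: R Q)
  case 0
  then show ?case using P by (auto simp: paired_def commutes_flip_def toffoli_count_def)
next
  case (Suc i)
  obtain R0 r where r0: "fold (red_step n) [0..<i] ([], P) = (R0, r)" by fastforce
  have i: "i < 2 ^ (n - 1)" and n1: "1 \<le> n" using Suc.prems n by auto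
  have r: "paired n (2 * i) r" and cost: "toffoli_count R0 \<le>
      (\<Sum>i<i. (if m_of n i < n then control_cost (m_of n i) else 0) + alloc_bound (n - 1) i)"
    using Suc.IH[OF _ r0] i by auto
  define m where "m = m_of n i"
  note m = m_of_bounds[OF n1 i, folded m_def]
  obtain a where a: "pick n m r = (a, flip_bit 0 a)" "a < 2 ^ n"
    "h n m \<le> column n r a" "h n m \<le> column n r (flip_bit 0 a)"
    using pick_succeeds[OF r n1 i] unfolding m_def by blast
  define C where "C = cons_gates n i m (column n r a) (column n r (flip_bit 0 a))"
  define r' where "r' = apply_gates n C r"
  define A where "A = alloc_gates n i (column n r' a div 2)"
  have RQ: "R = R0 @ C @ A" "Q = apply_gates n A r'"
    using Suc.prems(2) a(1)
    by (auto simp: r0 red_step_def[of n i] Let_def m_def[symmetric] C_def r'_def A_def)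
  note cs = cons_stage[OF r i n1 m(1-3) a(2-4), folded C_def, folded r'_def]
  have p: "is_perm n r" "is_perm n r'" using r cs(1) by (auto simp: paired_def)
  have b: "flip_bit 0 a < 2 ^ n" using n1 a(2) by (rule flip_last_less)
  \<comment> \<open>The two rows differ in parity, hence so do their columns as places in
    \<open>r\<close>.\<close>
  have "column n r a \<noteq> column n r (flip_bit 0 a)"
    using row_column[OF p(1) a(2)] row_column[OF p(1) b] flip_bit_0_odd[of a] by metis
  then have C: "toffoli_count C \<le> (if m < n then control_cost m else 0)"
    unfolding C_def using p a b m by (intro toffoli_count_cons_gates column_less) auto
  \<comment> \<open>Ensures that the block to be moved has index at least \<open>i\<close>, as the
    ALLOC bound demands.\<close>
  have ge: "2 * i \<le> column n r' a" using cs(3) m(3) by simp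
  have "column n r' a < 2 * 2 ^ (n - 1)" using column_less[OF p(2) a(2)] n1 by (cases n) auto
  then have "toffoli_count A \<le> alloc_bound (n - 1) i"
    unfolding A_def using ge by (intro toffoli_count_alloc_gates) auto
  then have "toffoli_count R \<le>
      (\<Sum>i<Suc i. (if m_of n i < n then control_cost (m_of n i) else 0) + alloc_bound (n - 1) i)"
    using cost C unfolding RQ toffoli_count_append m_def sum.lessThan_Suc by linarith
  moreover have "paired n (2 * Suc i) Q"
    unfolding RQ A_def by (rule alloc_stage[OF cs(1) i n1 a(2) ge cs(2)])
  ultimately show ?case by blast
qed

theorem theorem1:
  fixes n :: nat and P Q :: "nat \<Rightarrow> nat" and R :: "gate list"
  assumes "3 \<le> n"
    and "is_perm n P"
    and "normal_positions n P"
    and "A_red n P = (R, Q)"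
  shows "toffoli_count R \<le> N_c n + N_a n"
proof -
  define F where "F m = (if m < n then control_cost m else 0)" for m
  have "toffoli_count R \<le> (\<Sum>i<2 ^ (n - 1). F (m_of n i) + alloc_bound (n - 1) i)"
    using A_red_prefix[OF assms(1-3) order.refl] assms(4) by (simp add: A_red_def F_def)
  also have "\<dots> = F 1 + (\<Sum>m = 2..n. F m * 2 ^ (n - m)) + N_a n"
    using assms(1) by (simp only: sum.distrib sum_alloc_bound sum_m_of[OF order.trans[OF _ assms(1)], of F])
  also have "F 1 = 0" by (simp add: F_def control_cost_def)
  \<comment> \<open>The summand \<open>m = n\<close> disappears because \<open>F\<close> is zero
    there.\<close>
  also have "(\<Sum>m = 2..n. F m * 2 ^ (n - m)) = N_c n"
    unfolding N_c_def
    by (rule sum.mono_neutral_cong_right) (auto simp: F_def control_cost_def)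
  finally show ?thesis by simp
qed

end
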